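(* Let $\vec{x}^{(1)},\vec{x}^{(2)},\vec{x}^{(3)}\in\mathbb{R}^2$ satisfy, for each $i=1,2,3$, $\left|\sum_{j\neq i}\frac{\vec{x}^{(j)}-\vec{x}^{(i)}}{|\vec{x}^{(j)}-\vec{x}^{(i)}|}\right|>1$, and let $\vec{a}_\infty$ be the unique equilibrium point of $\vec{x}^{(1)},\vec{x}^{(2)},\vec{x}^{(3)}$. Let $\vec{a}_0\in\mathbb{R}^2$ and $\vec{\alpha}_0=(\alpha_0^{(1)},\alpha_0^{(2)},\alpha_0^{(3)})\in\mathbb{R}^3$ be initial data such that $$\sum_{j=1}^3\sigma(\Delta^{(j)}\alpha_0)\,|\vec{a}_0-\vec{x}^{(j)}|<\sigma(0)\,C_1 .$$ Then there exists a unique global in time solution $(\vec{\alpha},\vec{a})$ (i.e. a solution on $[0,\infty)$) of the grain boundary system with $\vec{\alpha}(0)=\vec{\alpha}_0$, $\vec{a}(0)=\vec{a}_0$.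
   Context: Constants $\gamma,\eta>0$ are fixed. The function $\sigma:\mathbb{R}\to\mathbb{R}$ is $C^3$ and satisfies: $\sigma(\theta)\ge\sigma(0)>0$ for all $\theta\in\mathbb{R}$; $\sigma_\theta(\theta)\theta\ge0$ for all $\theta\in\mathbb{R}$ and $\sigma_{\theta\theta}(0)>0$; and $\sigma_\theta(\theta)=0$ if and only if $\theta=0$ (subscripts denote derivatives). Indices are cyclic mod 3: $\alpha^{(0)}=\alpha^{(3)}$, $\alpha^{(4)}=\alpha^{(1)}$, $\vec{b}^{(4)}=\vec{b}^{(1)}$; and $\Delta^{(j)}\alpha:=\alpha^{(j-1)}-\alpha^{(j)}$ for $\vec{\alpha}=(\alpha^{(1)},\alpha^{(2)},\alpha^{(3)})\in\mathbb{R}^3$ (so $\Delta^{(4)}\alpha=\Delta^{(1)}\alpha$). $|\cdot|$ is the Euclidean norm. Grain boundary system, for unknowns $\vec{\alpha}(t)\in\mathbb{R}^3$, $\vec{a}(t)\in\mathbb{R}^2$, with $\vec{b}^{(j)}(t):=\vec{x}^{(j)}-\vec{a}(t)$: $$\frac{d\alpha^{(j)}}{dt}=-\gamma\Bigl(\sigma_\theta(\Delta^{(j+1)}\alpha)|\vec{b}^{(j+1)}|-\sigma_\theta(\Delta^{(j)}\alpha)|\vec{b}^{(j)}|\Bigr),\ j=1,2,3,\qquad \frac{d\vec{a}}{dt}=\eta\sum_{j=1}^3\sigma(\Delta^{(j)}\alpha)\frac{\vec{b}^{(j)}}{|\vec{b}^{(j)}|}.$$ A solution on a time interval is a $C^1$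 pair $(\vec{\alpha},\vec{a})$ satisfying these equations there, with $\vec{a}(t)\ne\vec{x}^{(j)}$ for all $t$ and $j$. The equilibrium point $\vec{a}_\infty\in\mathbb{R}^2$ is the point, distinct from all $\vec{x}^{(j)}$, with $\sum_{j=1}^3\vec{b}_\infty^{(j)}/|\vec{b}_\infty^{(j)}|=\vec{0}$, where $\vec{b}_\infty^{(j)}:=\vec{x}^{(j)}-\vec{a}_\infty$; under the stated condition on the $\vec{x}^{(j)}$ it exists and is unique (it is the Fermat–Torricelli point, the unique minimizer of $\vec{a}\mapsto\sum_j|\vec{x}^{(j)}-\vec{a}|$). Define $$C_1:=\inf\Bigl\{\sum_{j=1}^3|\vec{x}^{(j)}-\vec{a}|:\ \vec{a}\in\mathbb{R}^2,\ |\vec{a}-\vec{a}_\infty|\ge\tfrac12|\vec{b}_\infty^{(j)}|\ \text{for some } j\in\{1,2,3\}\Bigr\}.$$ *)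

theory Defs
  imports "HOL-Analysis.Analysis"
begin

text \<open>
  Indices range over the numeral type \<^typ>\<open>3\<close>, the ring of integers modulo 3, in which \<open>0 = 3\<close> and
  \<open>4 = 1\<close>. The cyclic conventions \<open>\<alpha>\<^sup>0 = \<alpha>\<^sup>3\<close>, \<open>\<alpha>\<^sup>4 = \<alpha>\<^sup>1\<close>, \<open>b\<^sup>4 = b\<^sup>1\<close> are thus the arithmetic of
  the index type.
\<close>

definition Delta :: "3 \<Rightarrow> real^3 \<Rightarrow> real" where
  "Delta j \<alpha> = \<alpha> $ (j - 1) - \<alpha> $ j"

definition Ck :: "nat \<Rightarrow> (real \<Rightarrow> real) \<Rightarrow> bool" where
  "Ck k f \<longleftrightarrow>
     (\<forall>i<k. \<forall>\<theta>. ((deriv ^^ i) f has_real_derivative (deriv ^^ Suc i) f \<theta>) (at \<theta>)) \<and>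
     continuous_on UNIV ((deriv ^^ k) f)"

text \<open>
  The library's \<open>C1_differentiable_on\<close> uses two-sided derivatives; here derivatives are taken
  within the interval, hence are one-sided at its endpoints.
\<close>

definition C1_within :: "real set \<Rightarrow> (real \<Rightarrow> 'a::real_normed_vector) \<Rightarrow> bool" where
  "C1_within I f \<longleftrightarrow>
     (\<exists>f'. (\<forall>t\<in>I. (f has_vector_derivative f' t) (at t within I)) \<and> continuous_on I f')"

definition grain_solution ::
    "real \<Rightarrow> real \<Rightarrow> (real \<Rightarrow> real) \<Rightarrow> (3 \<Rightarrow> real^2) \<Rightarrow> real set \<Rightarrow>
     (real \<Rightarrow> real^3) \<Rightarrow> (real \<Rightarrow> real^2) \<Rightarrow> bool" where
  "grain_solution \<gamma> \<eta> \<sigma> x I \<alpha> a \<longleftrightarrow>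
     C1_within I \<alpha> \<and> C1_within I a \<and>
     (\<forall>t\<in>I. \<forall>j. a t \<noteq> x j) \<and>
     (\<forall>t\<in>I. \<forall>j. ((\<lambda>s. \<alpha> s $ j) has_real_derivative
         - \<gamma> * (deriv \<sigma> (Delta (j + 1) (\<alpha> t)) * norm (x (j + 1) - a t)
                - deriv \<sigma> (Delta j (\<alpha> t)) * norm (x j - a t))) (at t within I)) \<and>
     (\<forall>t\<in>I. (a has_vector_derivative
         \<eta> *\<^sub>R (\<Sum>j\<in>UNIV. \<sigma> (Delta j (\<alpha> t)) *\<^sub>R ((x j - a t) /\<^sub>R norm (x j - a t))))
         (at t within I))"

definition is_equilibrium :: "(3 \<Rightarrow> real^2) \<Rightarrow> real^2 \<Rightarrow> bool" where
  "is_equilibrium x a \<longleftrightarrow>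
     (\<forall>j. a \<noteq> x j) \<and> (\<Sum>j\<in>UNIV. (x j - a) /\<^sub>R norm (x j - a)) = 0"

definition equilibrium :: "(3 \<Rightarrow> real^2) \<Rightarrow> real^2" where
  "equilibrium x = (THE a. is_equilibrium x a)"

definition C1 :: "(3 \<Rightarrow> real^2) \<Rightarrow> real" where
  "C1 x = (INF a \<in> {a. \<exists>j. norm (a - equilibrium x) \<ge> 1/2 * norm (x j - equilibrium x)}.
             \<Sum>j\<in>UNIV. norm (x j - a))"

end

theory Submission
  imports Defs
begin

text \<open>
  Along a solution the energy \<open>E = \<Sum>\<^sub>j \<sigma>(\<Delta>\<^sub>j \<alpha>) |b\<^sub>j|\<close> satisfies
  \<open>E' = - |\<alpha>'|\<^sup>2 / \<gamma> - |a'|\<^sup>2 / \<eta> \<le> 0\<close>, and \<open>(|\<alpha>|\<^sup>2)' = - 2 \<gamma> \<Sum>\<^sub>j \<sigma>'(\<Delta>\<^sub>j \<alpha>) \<Delta>\<^sub>j \<alpha> |b\<^sub>j| \<le> 0\<close>.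
  Since \<open>\<sigma>(0) \<Sum>\<^sub>j |b\<^sub>j| \<le> E < \<sigma>(0) C\<^sub>1\<close> is thus preserved, \<open>a\<close> never leaves the balls of radius
  \<open>|x\<^sub>j - a\<^sub>\<infinity>| / 2\<close> around \<open>a\<^sub>\<infinity>\<close>, and \<open>(\<alpha>, a)\<close> stays in a compact convex set \<open>K\<close> on which the
  vector field \<open>F\<close> is Lipschitz. Precomposing \<open>F\<close> with the nearest-point projection onto \<open>K\<close> gives
  a globally Lipschitz field with a unique global solution; by a first-exit argument that solution
  never leaves \<open>K\<close>, so it solves the original system, and every solution of the original system
  arises in this way.

  The balls have positive radius: were \<open>a\<^sub>\<infinity> = x\<^sub>j\<close> for some \<open>j\<close>, then \<open>C\<^sub>1\<close> would be an infimum over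
  the whole plane and no initial datum could satisfy the energy bound.
\<close>

subsection \<open>Ordinary differential equations with a Lipschitz field\<close>

lemma nonincreasing_if_derivative_nonpos:
  fixes g :: "real \<Rightarrow> real"
  assumes "0 \<le> T"
    and "\<And>t. t \<in> {0..T} \<Longrightarrow> (g has_real_derivative g' t) (at t within {0..T})"
    and "\<And>t. t \<in> {0..T} \<Longrightarrow> g' t \<le> 0"
  shows "g T \<le> g 0"
proof -
  have "\<exists>t\<in>{0..T}. g T - g 0 = (*) (g' t) (T - 0)"
    using assms by (intro mvt_very_simple) (auto simp: has_field_derivative_def)
  then show ?thesis
    using assms(1,3) by (smt (verit) mult_nonneg_nonneg mult_minus_left)
qed

lemma has_vector_derivative_half_line_integral:
  fixes h :: "real \<Rightarrow> 'a::banach"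
  assumes "continuous_on {0..} h" "t \<ge> 0"
  shows "((\<lambda>t. integral {0..t} h) has_vector_derivative h t) (at t within {0..})"
proof -
  \<comment> \<open>The fundamental theorem of calculus is applied on a compact interval. Ending it
    at \<open>t + 1\<close> keeps \<open>t\<close> away from its right end, so the derivative within
    it equals the one within the half line.\<close>
  have "((\<lambda>t. integral {0..t} h) has_vector_derivative h t) (at t within {0..t+1})"
    using assms(2) by (intro integral_has_vector_derivative continuous_on_subset[OF assms(1)]) auto
  moreover have "at t within {0..} = at t within {0..t+1}"
    by (rule at_within_nhd[where S = "{..<t+1}"]) auto
  ultimately show ?thesis by simp
qed

text \<open>Integrating \<open>exp (\<kappa> * s)\<close> up to \<open>t\<close> gives at most
  \<open>exp (\<kappa> * t) / \<kappa>\<close>, and the weight cancels the exponential. The gain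
  \<open>1 / \<kappa>\<close> serves twice below: it bounds the Picard iterates and produces the
  contraction factor \<open>L / \<kappa>\<close>.\<close>

lemma norm_exp_weighted_integral_le:
  fixes h :: "real \<Rightarrow> 'a::banach"
  assumes "0 < \<kappa>" "0 \<le> C" "0 \<le> t" and h: "continuous_on {0..} h"
    and le: "\<And>s. s \<ge> 0 \<Longrightarrow> norm (h s) \<le> C * exp (\<kappa> * s)"
  shows "norm (exp (- \<kappa> * t) *\<^sub>R integral {0..t} h) \<le> C / \<kappa>"
proof -
  have exp_integral: "((\<lambda>s. C * exp (\<kappa> * s)) has_integral (C * exp (\<kappa> * t) / \<kappa> - C * exp (\<kappa> * 0) / \<kappa>)) {0..t}"
    using \<open>0 < \<kappa>\<close> \<open>0 \<le> t\<close>
    by (intro fundamental_theorem_of_calculus)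
       (auto intro!: derivative_eq_intros simp flip: has_real_derivative_iff_has_vector_derivative)
  have "norm (integral {0..t} h) \<le> integral {0..t} (\<lambda>s. C * exp (\<kappa> * s))"
    using exp_integral le
    by (intro Henstock_Kurzweil_Integration.integral_norm_bound_integral
          integrable_continuous_interval continuous_on_subset[OF h]
          continuous_on_mult continuous_on_exp continuous_on_const continuous_on_id) auto
  also have "\<dots> = C * exp (\<kappa> * t) / \<kappa> - C * exp (\<kappa> * 0) / \<kappa>"
    using exp_integral by (rule integral_unique)
  also have "\<dots> \<le> C * exp (\<kappa> * t) / \<kappa>"
    using assms by simp
  finally have "exp (- \<kappa> * t) * norm (integral {0..t} h) \<le> exp (- \<kappa> * t) * (C * exp (\<kappa> * t) / \<kappa>)"
    by (rule mult_left_mono) simp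
  also have "\<dots> = C / \<kappa>"
    by (simp add: exp_minus)
  finally show ?thesis by simp
qed

text \<open>
  The weight \<open>exp (- \<kappa> t)\<close> with \<open>\<kappa> > L\<close> makes the Picard map a contraction on the whole half line;
  a bounded function \<open>v\<close> stands for the curve \<open>t \<mapsto> exp (\<kappa> t) v(t)\<close>.
\<close>

lemma lipschitz_ivp_global_solution:
  fixes f :: "'a::banach \<Rightarrow> 'a"
  assumes f: "L-lipschitz_on UNIV f"
  obtains z where "z 0 = z0"
    and "\<And>t. t \<ge> 0 \<Longrightarrow> (z has_vector_derivative f (z t)) (at t within {0..})"
proof -
  \<comment> \<open>This choice gives \<open>L / \<kappa> < 1\<close> and keeps
    \<open>\<kappa>\<close> positive even for \<open>L = 0\<close>.\<close>
  define \<kappa> where "\<kappa> = L + 1"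
  have L: "0 \<le> L" using f by (rule lipschitz_on_nonneg)
  then have \<kappa>: "0 < \<kappa>" by (simp add: \<kappa>_def)
  define h where "h v s = f (exp (\<kappa> * s) *\<^sub>R apply_bcontfun v s)" for v :: "real \<Rightarrow>\<^sub>C 'a" and s
  define J where "J v t = integral {0..t} (h v)" for v t
  \<comment> \<open>Bounded continuous functions live on the whole line here; \<open>max 0 t\<close>
    extends the weighted Picard iterate by the constant \<open>z0\<close> to negative times.\<close>
  define G where "G v t = exp (- \<kappa> * max 0 t) *\<^sub>R (z0 + J v (max 0 t))" for v t
  have cont_h: "continuous_on A (h v)" for A v
    unfolding h_def
    by (intro continuous_on_compose2[OF lipschitz_on_continuous_on[OF f]] continuous_intros) auto
  have J_deriv: "(J v has_vector_derivative h v t) (at t within {0..})" if "t \<ge> 0" for v t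
    unfolding J_def using that by (intro has_vector_derivative_half_line_integral cont_h)
  then have cont_J: "continuous_on {0..} (J v)" for v
    by (auto simp: continuous_on_eq_continuous_within intro: has_vector_derivative_continuous)
  have h_bound: "norm (h v s) \<le> (norm (f 0) + L * norm v) * exp (\<kappa> * s)" if "s \<ge> 0" for v s
  proof -
    have "norm (h v s) \<le> norm (f 0) + norm (h v s - f 0)"
      by (metis norm_triangle_sub)
    also have "norm (h v s - f 0) \<le> L * (exp (\<kappa> * s) * norm (apply_bcontfun v s))"
      using lipschitz_on_normD[OF f, of "exp (\<kappa> * s) *\<^sub>R apply_bcontfun v s" 0] by (simp add: h_def)
    also have "\<dots> \<le> L * (exp (\<kappa> * s) * norm v)"
      using L by (intro mult_left_mono norm_bounded) auto
    also have "norm (f 0) + \<dots> \<le> norm (f 0) * exp (\<kappa> * s) + \<dots>"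
      using \<kappa> that by (simp add: mult_le_cancel_left1)
    finally show ?thesis by (simp add: algebra_simps)
  qed
  have G_bcontfun: "G v \<in> bcontfun" for v
  proof (rule bcontfun_normI)
    show "continuous_on UNIV (G v)"
      unfolding G_def by (intro continuous_intros continuous_on_compose2[OF cont_J]) auto
    show "norm (G v t) \<le> norm z0 + (norm (f 0) + L * norm v) / \<kappa>" for t
    proof -
      have "norm (G v t) \<le> exp (- \<kappa> * max 0 t) * norm z0 + norm (exp (- \<kappa> * max 0 t) *\<^sub>R J v (max 0 t))"
        unfolding G_def scaleR_add_right by (rule norm_triangle_le) simp
      also have "exp (- \<kappa> * max 0 t) * norm z0 \<le> norm z0"
        using \<kappa> by (simp add: mult_left_le_one_le)
      also have "norm (exp (- \<kappa> * max 0 t) *\<^sub>R J v (max 0 t)) \<le> (norm (f 0) + L * norm v) / \<kappa>"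
        unfolding J_def using \<kappa> L by (intro norm_exp_weighted_integral_le cont_h h_bound) auto
      finally show ?thesis by simp
    qed
  qed
  have contraction: "dist (Bcontfun (G v)) (Bcontfun (G w)) \<le> L / \<kappa> * dist v w" for v w
  proof (rule dist_bound)
    fix t
    have "norm (h v s - h w s) \<le> L * dist v w * exp (\<kappa> * s)" for s
    proof -
      have "norm (h v s - h w s) \<le> L * (exp (\<kappa> * s) * dist (apply_bcontfun v s) (apply_bcontfun w s))"
        using lipschitz_on_normD[OF f, of "exp (\<kappa> * s) *\<^sub>R apply_bcontfun v s" "exp (\<kappa> * s) *\<^sub>R apply_bcontfun w s"]
        by (simp add: h_def dist_norm flip: scaleR_diff_right)
      also have "\<dots> \<le> L * (exp (\<kappa> * s) * dist v w)"
        using L by (intro mult_left_mono dist_bounded) auto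
      finally show ?thesis by (simp add: algebra_simps)
    qed
    then have "norm (exp (- \<kappa> * max 0 t) *\<^sub>R integral {0..max 0 t} (\<lambda>s. h v s - h w s))
        \<le> L * dist v w / \<kappa>"
      using \<kappa> L by (intro norm_exp_weighted_integral_le continuous_intros cont_h) auto
    also have "integral {0..max 0 t} (\<lambda>s. h v s - h w s) = J v (max 0 t) - J w (max 0 t)"
      unfolding J_def by (intro integral_diff integrable_continuous_interval cont_h)
    finally show "dist (apply_bcontfun (Bcontfun (G v)) t) (apply_bcontfun (Bcontfun (G w)) t) \<le> L / \<kappa> * dist v w"
      by (simp add: Bcontfun_inverse G_bcontfun G_def dist_norm algebra_simps)
  qed
  have "\<exists>!v. Bcontfun (G v) = v"
    using contraction L by (intro banach_fix_type[where c = "L / \<kappa>"]) (auto simp: \<kappa>_def)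
  then obtain v where "Bcontfun (G v) = v" by blast
  then have v: "apply_bcontfun v = G v"
    by (metis Bcontfun_inverse G_bcontfun)
  \<comment> \<open>Undoing the weight: the fixed point equation says
    \<open>exp (\<kappa> * t) *\<^sub>R v t = z0 + J v t\<close> for \<open>t \<ge> 0\<close>, so
    the integrand of \<open>J v\<close> is \<open>f (z t)\<close>.\<close>
  define z where "z t = z0 + J v t" for t
  have "(z has_vector_derivative f (z t)) (at t within {0..})" if "t \<ge> 0" for t
  proof -
    have "h v t = f (z t)"
      using that by (simp add: h_def v G_def z_def flip: exp_add)
    then show ?thesis
      unfolding z_def using J_deriv[OF that, of v]
      by (auto intro!: derivative_eq_intros simp: z_def)
  qed
  moreover have "z 0 = z0" by (simp add: z_def J_def)
  ultimately show thesis using that by blast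
qed

text \<open>Gronwall argument: by Cauchy-Schwarz and the Lipschitz bound, the squared distance of
  the two solutions weighted by \<open>exp (- 2 * L * t)\<close> cannot increase, and it starts at
  0.\<close>

lemma lipschitz_ivp_unique:
  fixes f :: "'a::real_inner \<Rightarrow> 'a"
  assumes f: "L-lipschitz_on UNIV f"
    and z: "\<And>t. t \<ge> 0 \<Longrightarrow> (z has_vector_derivative f (z t)) (at t within {0..})"
    and w: "\<And>t. t \<ge> 0 \<Longrightarrow> (w has_vector_derivative f (w t)) (at t within {0..})"
    and "z 0 = w 0" "T \<ge> 0"
  shows "z T = w T"
proof -
  define d where "d t = z t - w t" for t
  define g where "g t = exp (- 2 * L * t) * (d t \<bullet> d t)" for t
  define g' where "g' t = 2 * exp (- 2 * L * t) * (d t \<bullet> (f (z t) - f (w t)) - L * (d t \<bullet> d t))" for t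
  have "g T \<le> g 0"
  proof (rule nonincreasing_if_derivative_nonpos[OF \<open>T \<ge> 0\<close>])
    fix t assume t: "t \<in> {0..T}"
    have d: "(d has_vector_derivative (f (z t) - f (w t))) (at t within {0..T})"
      unfolding d_def using t z[of t] w[of t]
      by (intro derivative_intros) (auto intro: has_vector_derivative_within_subset)
    show "(g has_real_derivative g' t) (at t within {0..T})"
      unfolding g_def has_field_derivative_def
      by (rule derivative_eq_intros refl d[unfolded has_vector_derivative_def])+
         (auto simp: fun_eq_iff g'_def algebra_simps inner_commute)
    have "d t \<bullet> (f (z t) - f (w t)) \<le> norm (d t) * norm (f (z t) - f (w t))"
      by (rule norm_cauchy_schwarz)
    also have "\<dots> \<le> norm (d t) * (L * norm (d t))"
      unfolding d_def by (intro mult_left_mono lipschitz_on_normD[OF f]) auto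
    also have "\<dots> = L * (d t \<bullet> d t)"
      by (simp add: dot_square_norm power2_eq_square)
    finally show "g' t \<le> 0"
      by (simp add: g'_def mult_le_0_iff)
  qed
  then have "d T \<bullet> d T \<le> 0"
    using \<open>z 0 = w 0\<close> by (simp add: g_def d_def mult_le_0_iff)
  then have "d T = 0"
    by (metis inner_ge_zero inner_eq_zero_iff order_antisym)
  then show ?thesis by (simp add: d_def)
qed

text \<open>Openness of \<open>U\<close> makes the first exit time attained, and closedness of
  \<open>K\<close> carries membership from earlier times to that time. Then \<open>step\<close> puts
  the curve back into \<open>U\<close> at the exit time, a contradiction.\<close>

lemma stays_in_if_no_first_exit:
  fixes z :: "real \<Rightarrow> 'a::topological_space"
  assumes z: "continuous_on {0..} z" and "open U" "closed K" "U \<subseteq> K" "z 0 \<in> K"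
    and step: "\<And>T. T \<ge> 0 \<Longrightarrow> (\<And>t. t \<in> {0..T} \<Longrightarrow> z t \<in> K) \<Longrightarrow> z T \<in> U"
    and "t \<ge> 0"
  shows "z t \<in> U"
proof (rule ccontr)
  assume "z t \<notin> U"
  define S where "S = {0..} \<inter> z -` (- U)"
  have "closed S"
    unfolding S_def using \<open>open U\<close> by (intro continuous_closed_preimage z) auto
  moreover have "S \<noteq> {}" "bdd_below S"
    using \<open>z t \<notin> U\<close> \<open>t \<ge> 0\<close> by (auto simp: S_def intro!: bdd_belowI[where m = 0])
  ultimately have T: "Inf S \<in> S"
    by (simp add: closed_contains_Inf)
  have before: "z s \<in> U" if "0 \<le> s" "s < Inf S" for s
    using that cInf_lower[OF _ \<open>bdd_below S\<close>, of s] by (force simp: S_def)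
  have "z s \<in> K" if "s \<in> {0..Inf S}" for s
  proof (cases "Inf S = 0")
    case True
    \<comment> \<open>An exit at time 0 has no earlier times to take limits from, so the initial
      condition is used.\<close>
    then show ?thesis using that \<open>z 0 \<in> K\<close> by auto
  next
    case False
    with T have "0 < Inf S" by (auto simp: S_def)
    then have "z ` closure {0..<Inf S} \<subseteq> K"
      using before \<open>U \<subseteq> K\<close> \<open>closed K\<close>
      by (intro image_closure_subset continuous_on_subset[OF z]) auto
    then show ?thesis using \<open>0 < Inf S\<close> that by auto
  qed
  then have "z (Inf S) \<in> U"
    using T by (intro step) (auto simp: S_def)
  with T show False by (simp add: S_def)
qed

subsection \<open>Lipschitz functions with unspecified constant\<close>

text \<open>Hiding the constant lets the closure rules below chain along the structure of the vector
  field without computing constants.\<close>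

definition lipschitzian_on :: "'a::metric_space set \<Rightarrow> ('a \<Rightarrow> 'b::metric_space) \<Rightarrow> bool" where
  "lipschitzian_on K f \<longleftrightarrow> (\<exists>L. L-lipschitz_on K f)"

lemma lipschitzian_onI: "L-lipschitz_on K f \<Longrightarrow> lipschitzian_on K f"
  by (auto simp: lipschitzian_on_def)

lemma lipschitzian_onE:
  assumes "lipschitzian_on K f"
  obtains L where "L-lipschitz_on K f"
  using assms by (auto simp: lipschitzian_on_def)

lemma lipschitzian_on_bounded_image:
  assumes "lipschitzian_on K f" "bounded K"
  shows "bounded (f ` K)"
proof -
  obtain L where L: "L-lipschitz_on K f"
    using assms(1) by (rule lipschitzian_onE)
  obtain e where e: "\<And>y z. y \<in> K \<Longrightarrow> z \<in> K \<Longrightarrow> dist y z \<le> e"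
    using \<open>bounded K\<close> unfolding bounded_two_points by auto
  have "dist (f y) (f z) \<le> L * e" if "y \<in> K" "z \<in> K" for y z
    using lipschitz_onD[OF L that] mult_left_mono[OF e[OF that] lipschitz_on_nonneg[OF L]] by simp
  then show ?thesis
    by (auto simp: bounded_two_points)
qed

lemma lipschitzian_on_const: "lipschitzian_on K (\<lambda>z. c)"
  by (rule lipschitzian_onI[OF lipschitz_on_constant])

lemma lipschitzian_on_compose:
  assumes "lipschitzian_on K f" "lipschitzian_on (f ` K) g"
  shows "lipschitzian_on K (\<lambda>z. g (f z))"
  using assms
  by (elim lipschitzian_onE) (rule lipschitzian_onI[OF lipschitz_on_compose2[where f = f and g = g]])

lemma lipschitzian_on_bounded_linear:
  assumes "bounded_linear f"
  shows "lipschitzian_on K f"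
proof -
  obtain B where "B-lipschitz_on K f"
    using assms by (rule bounded_linear.lipschitz_boundE)
  then show ?thesis by (rule lipschitzian_onI)
qed

lemma lipschitzian_on_add:
  fixes f g :: "_ \<Rightarrow> 'b::real_normed_vector"
  assumes "lipschitzian_on K f" "lipschitzian_on K g"
  shows "lipschitzian_on K (\<lambda>z. f z + g z)"
  using assms by (elim lipschitzian_onE) (rule lipschitzian_onI[OF lipschitz_on_add])

lemma lipschitzian_on_diff:
  fixes f g :: "_ \<Rightarrow> 'b::real_normed_vector"
  assumes "lipschitzian_on K f" "lipschitzian_on K g"
  shows "lipschitzian_on K (\<lambda>z. f z - g z)"
  using assms by (elim lipschitzian_onE) (rule lipschitzian_onI[OF lipschitz_on_diff])

lemma lipschitzian_on_sum:
  fixes f :: "'i \<Rightarrow> _ \<Rightarrow> 'b::real_normed_vector"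
  assumes "\<And>i. i \<in> A \<Longrightarrow> lipschitzian_on K (f i)"
  shows "lipschitzian_on K (\<lambda>z. \<Sum>i\<in>A. f i z)"
  using assms
  by (induction A rule: infinite_finite_induct)
     (simp_all add: lipschitzian_on_const lipschitzian_on_add)

lemma lipschitzian_on_Pair:
  assumes "lipschitzian_on K f" "lipschitzian_on K g"
  shows "lipschitzian_on K (\<lambda>z. (f z, g z))"
  using assms by (elim lipschitzian_onE) (rule lipschitzian_onI[OF lipschitz_on_Pair])

text \<open>Product estimate: each factor is Lipschitz, hence bounded on the bounded set
  \<open>K\<close>, and the increment of the product splits into two terms with one factor frozen in
  each.\<close>

lemma lipschitzian_on_scaleR:
  fixes f :: "'a::metric_space \<Rightarrow> real" and g :: "'a \<Rightarrow> 'b::real_normed_vector"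
  assumes "bounded K" and f: "lipschitzian_on K f" and g: "lipschitzian_on K g"
  shows "lipschitzian_on K (\<lambda>z. f z *\<^sub>R g z)"
proof -
  obtain L M where L: "L-lipschitz_on K f" and M: "M-lipschitz_on K g"
    using f g by (auto simp: lipschitzian_on_def)
  obtain A B where A: "A > 0" "\<And>z. z \<in> K \<Longrightarrow> norm (f z) \<le> A" and B: "B > 0" "\<And>z. z \<in> K \<Longrightarrow> norm (g z) \<le> B"
    using lipschitzian_on_bounded_image[OF f \<open>bounded K\<close>]
      lipschitzian_on_bounded_image[OF g \<open>bounded K\<close>]
    by (auto simp: bounded_pos)
  have "(A * M + B * L)-lipschitz_on K (\<lambda>z. f z *\<^sub>R g z)"
  proof (rule lipschitz_onI)
    show "0 \<le> A * M + B * L"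
      using A B lipschitz_on_nonneg[OF L] lipschitz_on_nonneg[OF M] by simp
    fix y z assume y: "y \<in> K" and z: "z \<in> K"
    have "dist (f y *\<^sub>R g y) (f z *\<^sub>R g z) = norm (f y *\<^sub>R (g y - g z) + (f y - f z) *\<^sub>R g z)"
      by (simp add: dist_norm algebra_simps)
    also have "\<dots> \<le> norm (f y) * norm (g y - g z) + norm (f y - f z) * norm (g z)"
      by (rule norm_triangle_le) simp
    also have "\<dots> \<le> A * (M * dist y z) + (L * dist y z) * B"
      using A B y z lipschitz_onD[OF L y z] lipschitz_onD[OF M y z] lipschitz_on_nonneg[OF L]
      by (intro add_mono mult_mono) (auto simp: dist_norm)
    finally show "dist (f y *\<^sub>R g y) (f z *\<^sub>R g z) \<le> (A * M + B * L) * dist y z"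
      by (simp add: algebra_simps)
  qed
  then show ?thesis by (rule lipschitzian_onI)
qed

lemmas lipschitzian_on_mult = lipschitzian_on_scaleR[where ?'b = real, unfolded real_scaleR_def]

lemma lipschitzian_on_norm:
  assumes "lipschitzian_on K f"
  shows "lipschitzian_on K (\<lambda>z. norm (f z))"
proof (rule lipschitzian_on_compose[OF assms])
  have "1-lipschitz_on (f ` K) norm"
    by (intro lipschitz_onI) (auto simp: dist_norm norm_triangle_ineq3)
  then show "lipschitzian_on (f ` K) norm"
    by (rule lipschitzian_onI)
qed

text \<open>The values of \<open>f\<close> on \<open>K\<close> lie in a compact interval, where the
  continuous \<open>g'\<close> is bounded; the mean value inequality does the rest. It is applied to
  \<open>\<sigma>\<close> and to \<open>deriv \<sigma>\<close>.\<close>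

lemma lipschitzian_on_C1:
  fixes g :: "real \<Rightarrow> real"
  assumes "\<And>\<theta>. (g has_real_derivative g' \<theta>) (at \<theta>)" "continuous_on UNIV g'"
    and f: "lipschitzian_on K f" and K: "bounded K"
  shows "lipschitzian_on K (\<lambda>z. g (f z))"
proof -
  obtain B where "\<forall>y\<in>f ` K. norm y \<le> B"
    using lipschitzian_on_bounded_image[OF f K] unfolding bounded_iff by blast
  then have B: "f ` K \<subseteq> {-B..B}"
    by (auto simp: abs_le_iff)
  have "bounded (g' ` {-B..B})"
    using assms(2) by (intro compact_imp_bounded compact_continuous_image) (auto intro: continuous_on_subset)
  then obtain M where M: "M > 0" "\<And>\<theta>. \<theta> \<in> {-B..B} \<Longrightarrow> norm (g' \<theta>) \<le> M"
    by (auto simp: bounded_pos)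
  have "M-lipschitz_on {-B..B} g"
  proof (rule bounded_derivative_imp_lipschitz)
    show "(g has_derivative (*) (g' \<theta>)) (at \<theta> within {-B..B})" for \<theta>
      using assms(1)[of \<theta>] by (auto simp: has_field_derivative_def intro: has_derivative_at_withinI)
    show "onorm ((*) (g' \<theta>)) \<le> M" if "\<theta> \<in> {-B..B}" for \<theta>
      using M(2)[OF that] by (intro onorm_le) (auto simp: abs_mult intro!: mult_right_mono)
  qed (use M in auto)
  then have "lipschitzian_on (f ` K) g"
    by (rule lipschitzian_onI[OF lipschitz_on_subset[OF _ B]])
  with f show ?thesis by (rule lipschitzian_on_compose)
qed

lemma lipschitzian_on_inverse:
  fixes f :: "'a::metric_space \<Rightarrow> real"
  assumes "lipschitzian_on K f" "c > 0" and c: "\<And>z. z \<in> K \<Longrightarrow> c \<le> f z"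
  shows "lipschitzian_on K (\<lambda>z. inverse (f z))"
proof (rule lipschitzian_on_compose[OF assms(1)])
  have "(1 / c\<^sup>2)-lipschitz_on (f ` K) inverse"
  proof (rule lipschitz_onI)
    fix u v assume "u \<in> f ` K" "v \<in> f ` K"
    then have uv: "c \<le> u" "c \<le> v" using c by auto
    then have "dist (inverse u) (inverse v) = dist u v / (u * v)"
      using \<open>c > 0\<close> by (simp add: dist_real_def inverse_diff_inverse abs_mult field_simps abs_minus_commute)
    also have "\<dots> \<le> dist u v / (c * c)"
      using uv \<open>c > 0\<close> by (intro divide_left_mono mult_mono) auto
    finally show "dist (inverse u) (inverse v) \<le> 1 / c\<^sup>2 * dist u v"
      by (simp add: power2_eq_square)
  qed (use \<open>c > 0\<close> in auto)
  then show "lipschitzian_on (f ` K) inverse"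
    by (rule lipschitzian_onI)
qed

subsection \<open>The grain boundary system\<close>

text \<open>The right-hand side as an autonomous field on pairs (orientations, junction), written
  along the axis basis so that the Lipschitz rules for sums and scalings apply. At a junction equal
  to some \<open>x j\<close> the undefined unit vector takes the value 0.\<close>

definition grain_field ::
    "real \<Rightarrow> real \<Rightarrow> (real \<Rightarrow> real) \<Rightarrow> (3 \<Rightarrow> real^2) \<Rightarrow> (real^3) \<times> (real^2) \<Rightarrow> (real^3) \<times> (real^2)" where
  "grain_field \<gamma> \<eta> \<sigma> x z =
     (\<Sum>j\<in>UNIV. (- \<gamma> * (deriv \<sigma> (Delta (j + 1) (fst z)) * norm (x (j + 1) - snd z)
                - deriv \<sigma> (Delta j (fst z)) * norm (x j - snd z))) *\<^sub>R axis j 1,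
      \<eta> *\<^sub>R (\<Sum>j\<in>UNIV. \<sigma> (Delta j (fst z)) *\<^sub>R ((x j - snd z) /\<^sub>R norm (x j - snd z))))"

lemma fst_grain_field_nth:
  "fst (grain_field \<gamma> \<eta> \<sigma> x z) $ j =
     - \<gamma> * (deriv \<sigma> (Delta (j + 1) (fst z)) * norm (x (j + 1) - snd z)
           - deriv \<sigma> (Delta j (fst z)) * norm (x j - snd z))"
  by (simp add: grain_field_def axis_def if_distrib[of "(*) _"] sum_negf cong: if_cong)

text \<open>The length of each grain boundary weighted by its tension. The system is the gradient
  flow of this energy with mobilities \<open>\<gamma>\<close> and \<open>\<eta>\<close>.\<close>

definition grain_energy :: "(real \<Rightarrow> real) \<Rightarrow> (3 \<Rightarrow> real^2) \<Rightarrow> (real^3) \<times> (real^2) \<Rightarrow> real" where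
  "grain_energy \<sigma> x z = (\<Sum>j\<in>UNIV. \<sigma> (Delta j (fst z)) * norm (x j - snd z))"

text \<open>The only singular factors are \<open>1 / norm (x j - a)\<close>, tamed by the distance
  to each \<open>x j\<close>; the rest is built from \<open>\<sigma>\<close>,
  \<open>deriv \<sigma>\<close>, norms and linear maps by sums and products on a bounded
  set.\<close>

lemma lipschitzian_on_grain_field:
  assumes "Ck 3 \<sigma>" "bounded K"
    and away: "\<And>j. \<exists>c>0. \<forall>z\<in>K. c \<le> norm (x j - snd z)"
  shows "lipschitzian_on K (grain_field \<gamma> \<eta> \<sigma> x)"
proof -
  have ders: "((deriv ^^ i) \<sigma> has_real_derivative (deriv ^^ Suc i) \<sigma> \<theta>) (at \<theta>)" if "i < 3" for i \<theta>
    using \<open>Ck 3 \<sigma>\<close> that by (auto simp: Ck_def)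
  have d0: "(\<sigma> has_real_derivative deriv \<sigma> \<theta>) (at \<theta>)"
    and d1: "(deriv \<sigma> has_real_derivative deriv (deriv \<sigma>) \<theta>) (at \<theta>)"
    and d2: "(deriv (deriv \<sigma>) has_real_derivative deriv (deriv (deriv \<sigma>)) \<theta>) (at \<theta>)" for \<theta>
    using ders[of 0] ders[of 1] ders[of 2] by (simp_all add: numeral_2_eq_2)
  have cont: "continuous_on UNIV (deriv \<sigma>)" "continuous_on UNIV (deriv (deriv \<sigma>))"
    using d1 d2 by (auto intro!: DERIV_continuous_on)
  have "bounded_linear (\<lambda>z :: (real^3) \<times> (real^2). Delta j (fst z))" for j
    unfolding Delta_def
    by (intro bounded_linear_sub bounded_linear_compose[OF bounded_linear_vec_nth bounded_linear_fst])
  note Delta = lipschitzian_on_bounded_linear[OF this, of K]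
  have b: "lipschitzian_on K (\<lambda>z. x j - snd z)" for j
    by (intro lipschitzian_on_diff lipschitzian_on_const lipschitzian_on_bounded_linear bounded_linear_snd)
  have inverse_norm: "lipschitzian_on K (\<lambda>z. inverse (norm (x j - snd z)))" for j
  proof -
    obtain c where "c > 0" "\<And>z. z \<in> K \<Longrightarrow> c \<le> norm (x j - snd z)"
      using away[of j] by blast
    then show ?thesis
      by (intro lipschitzian_on_inverse[where c = c] lipschitzian_on_norm b)
  qed
  show ?thesis
    unfolding grain_field_def
    by (intro lipschitzian_on_Pair lipschitzian_on_sum lipschitzian_on_scaleR lipschitzian_on_mult
          lipschitzian_on_diff lipschitzian_on_const lipschitzian_on_norm b inverse_norm \<open>bounded K\<close>
          lipschitzian_on_C1[OF d0 cont(1)] lipschitzian_on_C1[OF d1 cont(2)] Delta)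
qed

lemma has_vector_derivative_if_grain_solution:
  assumes sol: "grain_solution \<gamma> \<eta> \<sigma> x I \<alpha> a" and "t \<in> I"
  shows "((\<lambda>s. (\<alpha> s, a s)) has_vector_derivative grain_field \<gamma> \<eta> \<sigma> x (\<alpha> t, a t)) (at t within I)"
proof -
  let ?F = "grain_field \<gamma> \<eta> \<sigma> x (\<alpha> t, a t)"
  have "((\<lambda>s. \<alpha> s $ j) has_real_derivative fst ?F $ j) (at t within I)" for j
    unfolding fst_grain_field_nth fst_conv snd_conv
    using sol \<open>t \<in> I\<close> unfolding grain_solution_def by blast
  \<comment> \<open>Expansion in the standard basis assembles the scalar derivatives into one
    derivative of the vector \<open>\<alpha>\<close>.\<close>
  then have "((\<lambda>s. \<Sum>j\<in>UNIV. \<alpha> s $ j *\<^sub>R (axis j 1 :: real^3)) has_vector_derivative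
      (\<Sum>j\<in>UNIV. fst ?F $ j *\<^sub>R axis j 1)) (at t within I)"
    unfolding has_real_derivative_iff_has_vector_derivative
    by (intro has_vector_derivative_sum bounded_linear.has_vector_derivative[OF bounded_linear_scaleR_left])
  then have \<alpha>: "(\<alpha> has_vector_derivative fst ?F) (at t within I)"
    by (simp only: basis_expansion flip: scalar_mult_eq_scaleR)
  have a: "(a has_vector_derivative snd ?F) (at t within I)"
    unfolding grain_field_def fst_conv snd_conv
    using sol \<open>t \<in> I\<close> unfolding grain_solution_def by blast
  show ?thesis
    using has_vector_derivative_Pair[OF \<alpha> a] by (simp only: prod.collapse)
qed

lemma grain_solution_if_has_vector_derivative:
  assumes z: "\<And>t. t \<in> I \<Longrightarrow> (z has_vector_derivative grain_field \<gamma> \<eta> \<sigma> x (z t)) (at t within I)"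
    and cont: "continuous_on I (\<lambda>t. grain_field \<gamma> \<eta> \<sigma> x (z t))"
    and ne: "\<And>t j. t \<in> I \<Longrightarrow> snd (z t) \<noteq> x j"
  shows "grain_solution \<gamma> \<eta> \<sigma> x I (\<lambda>t. fst (z t)) (\<lambda>t. snd (z t))"
proof -
  let ?F = "\<lambda>t. grain_field \<gamma> \<eta> \<sigma> x (z t)"
  have d1: "((\<lambda>t. fst (z t)) has_vector_derivative fst (?F t)) (at t within I)"
    and d2: "((\<lambda>t. snd (z t)) has_vector_derivative snd (?F t)) (at t within I)" if "t \<in> I" for t
    using z[OF that]
    by (auto intro: bounded_linear.has_vector_derivative bounded_linear_fst bounded_linear_snd)
  show ?thesis
    unfolding grain_solution_def
  proof (intro conjI ballI allI)
    show "C1_within I (\<lambda>t. fst (z t))"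
      unfolding C1_within_def using d1 continuous_on_fst[OF cont]
      by (intro exI[where x = "\<lambda>t. fst (?F t)"]) simp
    show "C1_within I (\<lambda>t. snd (z t))"
      unfolding C1_within_def using d2 continuous_on_snd[OF cont]
      by (intro exI[where x = "\<lambda>t. snd (?F t)"]) simp
    fix t assume t: "t \<in> I"
    show "snd (z t) \<noteq> x j" for j
      using t by (rule ne)
    have "((\<lambda>t. fst (z t) $ j) has_real_derivative fst (?F t) $ j) (at t within I)" for j
      unfolding has_real_derivative_iff_has_vector_derivative
      using d1[OF t] by (rule bounded_linear.has_vector_derivative[OF bounded_linear_vec_nth])
    then show "((\<lambda>t. fst (z t) $ j) has_real_derivative
        - \<gamma> * (deriv \<sigma> (Delta (j + 1) (fst (z t))) * norm (x (j + 1) - snd (z t))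
               - deriv \<sigma> (Delta j (fst (z t))) * norm (x j - snd (z t)))) (at t within I)" for j
      unfolding fst_grain_field_nth .
    show "((\<lambda>t. snd (z t)) has_vector_derivative
        \<eta> *\<^sub>R (\<Sum>j\<in>UNIV. \<sigma> (Delta j (fst (z t))) *\<^sub>R ((x j - snd (z t)) /\<^sub>R norm (x j - snd (z t)))))
        (at t within I)"
      using d2[OF t] unfolding grain_field_def snd_conv .
  qed
qed

section \<open>Monotone quantities along solutions\<close>

text \<open>Summation by parts without boundary terms, as the indices are cyclic. It moves the
  difference onto \<open>p\<close>, where it matches the right-hand side of the equation for the
  orientations.\<close>

lemma sum_by_parts_cyclic:
  fixes p u :: "3 \<Rightarrow> real"
  shows "(\<Sum>j\<in>UNIV. p j * (u (j - 1) - u j)) = (\<Sum>j\<in>UNIV. (p (j + 1) - p j) * u j)"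
proof -
  have "(\<Sum>j\<in>UNIV. p j * u (j - 1)) = (\<Sum>j\<in>UNIV. p (j + 1) * u j)"
    by (rule sum.reindex_bij_witness[where i = "\<lambda>j. j + 1" and j = "\<lambda>j. j - 1"]) auto
  then show ?thesis
    by (simp add: algebra_simps sum_subtractf)
qed

lemma has_real_derivative_norm_within:
  fixes u :: "real \<Rightarrow> 'a::real_inner"
  assumes "(u has_vector_derivative u') (at t within I)" "u t \<noteq> 0"
  shows "((\<lambda>s. norm (u s)) has_real_derivative (sgn (u t) \<bullet> u')) (at t within I)"
proof -
  have "((\<lambda>s. norm (u s)) has_derivative (\<lambda>h. (h *\<^sub>R u') \<bullet> sgn (u t))) (at t within I)"
    using has_derivative_compose[OF assms(1)[unfolded has_vector_derivative_def] has_derivative_norm[OF assms(2)]] .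
  then show ?thesis
    by (simp add: has_field_derivative_def inner_commute mult_commute_abs)
qed

context
  fixes \<gamma> \<eta> :: real and \<sigma> :: "real \<Rightarrow> real" and x :: "3 \<Rightarrow> real^2"
    and z :: "real \<Rightarrow> (real^3) \<times> (real^2)" and T :: real
  assumes \<gamma>: "\<gamma> > 0" and T: "0 \<le> T"
    and z: "\<And>t. t \<in> {0..T} \<Longrightarrow>
      (z has_vector_derivative grain_field \<gamma> \<eta> \<sigma> x (z t)) (at t within {0..T})"
begin

private lemma fst_deriv:
  assumes "t \<in> {0..T}"
  shows "((\<lambda>s. fst (z s) $ j) has_real_derivative fst (grain_field \<gamma> \<eta> \<sigma> x (z t)) $ j) (at t within {0..T})"
  unfolding has_real_derivative_iff_has_vector_derivative
  using z[OF assms]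
  by (intro bounded_linear.has_vector_derivative[OF bounded_linear_vec_nth]
        bounded_linear.has_vector_derivative[OF bounded_linear_fst])

text \<open>Gradient flow structure: varying the tensions contributes, after summation by parts,
  \<open>- \<gamma>\<close> times a sum of squares, and varying the lengths contributes
  \<open>- \<eta> * (S \<bullet> S)\<close>. Staying off the \<open>x j\<close> makes the lengths
  differentiable.\<close>

lemma grain_energy_nonincreasing:
  assumes \<eta>: "\<eta> > 0"
    and \<sigma>: "\<And>\<theta>. (\<sigma> has_real_derivative deriv \<sigma> \<theta>) (at \<theta>)"
    and ne: "\<And>t j. t \<in> {0..T} \<Longrightarrow> snd (z t) \<noteq> x j"
  shows "grain_energy \<sigma> x (z T) \<le> grain_energy \<sigma> x (z 0)"
proof (rule nonincreasing_if_derivative_nonpos[OF T])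
  fix t assume t: "t \<in> {0..T}"
  \<comment> \<open>\<open>u\<close> is the velocity of the orientations, driven by differences of
    the \<open>p j\<close>; \<open>S\<close> is the resultant of the tensions at the junction, which
    moves with velocity \<open>\<eta> *\<^sub>R S\<close>.\<close>
  define u where "u j = fst (grain_field \<gamma> \<eta> \<sigma> x (z t)) $ j" for j
  define p where "p j = deriv \<sigma> (Delta j (fst (z t))) * norm (x j - snd (z t))" for j
  define S where "S = (\<Sum>j\<in>UNIV. \<sigma> (Delta j (fst (z t))) *\<^sub>R sgn (x j - snd (z t)))"
  have u: "u j = - \<gamma> * (p (j + 1) - p j)" for j
    by (simp only: u_def p_def fst_grain_field_nth)
  have "snd (grain_field \<gamma> \<eta> \<sigma> x (z t)) = \<eta> *\<^sub>R S"
    by (simp add: grain_field_def S_def sgn_div_norm)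
  then have "((\<lambda>s. snd (z s)) has_vector_derivative \<eta> *\<^sub>R S) (at t within {0..T})"
    using bounded_linear.has_vector_derivative[OF bounded_linear_snd z[OF t]] by simp
  then have "((\<lambda>s. x j - snd (z s)) has_vector_derivative - (\<eta> *\<^sub>R S)) (at t within {0..T})" for j
    by (auto intro!: derivative_eq_intros)
  then have norm_deriv: "((\<lambda>s. norm (x j - snd (z s))) has_real_derivative
      sgn (x j - snd (z t)) \<bullet> (- (\<eta> *\<^sub>R S))) (at t within {0..T})" for j
    using ne[OF t, of j] by (intro has_real_derivative_norm_within) auto
  have "((\<lambda>s. Delta j (fst (z s))) has_real_derivative u (j - 1) - u j) (at t within {0..T})" for j
    unfolding Delta_def u_def by (intro derivative_intros fst_deriv t)
  then have "((\<lambda>s. \<sigma> (Delta j (fst (z s)))) has_real_derivative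
      deriv \<sigma> (Delta j (fst (z t))) * (u (j - 1) - u j)) (at t within {0..T})" for j
    by (rule DERIV_chain2[OF \<sigma>])
  from DERIV_mult[OF this norm_deriv]
  show "((\<lambda>s. grain_energy \<sigma> x (z s)) has_real_derivative
      (\<Sum>j\<in>UNIV. deriv \<sigma> (Delta j (fst (z t))) * (u (j - 1) - u j) * norm (x j - snd (z t))
        + sgn (x j - snd (z t)) \<bullet> (- (\<eta> *\<^sub>R S)) * \<sigma> (Delta j (fst (z t))))) (at t within {0..T})"
    unfolding grain_energy_def by (intro DERIV_sum)
  have "(\<Sum>j\<in>UNIV. sgn (x j - snd (z t)) \<bullet> (- (\<eta> *\<^sub>R S)) * \<sigma> (Delta j (fst (z t)))) = - \<eta> * (S \<bullet> S)"
    \<comment> \<open>Only the left factor of \<open>S \<bullet> S\<close> is expanded, so that both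
      sides become sums of inner products with the same \<open>S\<close>.\<close>
    by (subst (2) S_def) (simp add: inner_sum_left sum_distrib_left sum_negf algebra_simps)
  moreover have "0 \<le> \<gamma> * (\<Sum>j\<in>UNIV. (p (j + 1) - p j)\<^sup>2)" "0 \<le> \<eta> * (S \<bullet> S)"
    using \<gamma> \<eta> by (simp_all add: sum_nonneg)
  moreover have "(\<Sum>j\<in>UNIV. deriv \<sigma> (Delta j (fst (z t))) * (u (j - 1) - u j) * norm (x j - snd (z t)))
      = - \<gamma> * (\<Sum>j\<in>UNIV. (p (j + 1) - p j)\<^sup>2)"
  proof -
    have "(\<Sum>j\<in>UNIV. deriv \<sigma> (Delta j (fst (z t))) * (u (j - 1) - u j) * norm (x j - snd (z t)))
        = (\<Sum>j\<in>UNIV. p j * (u (j - 1) - u j))"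
      by (simp add: p_def mult_ac)
    also have "\<dots> = (\<Sum>j\<in>UNIV. (p (j + 1) - p j) * u j)"
      by (rule sum_by_parts_cyclic)
    also have "\<dots> = - \<gamma> * (\<Sum>j\<in>UNIV. (p (j + 1) - p j)\<^sup>2)"
      unfolding sum_distrib_left by (intro sum.cong refl) (simp add: u power2_eq_square)
    finally show ?thesis .
  qed
  ultimately show "(\<Sum>j\<in>UNIV. deriv \<sigma> (Delta j (fst (z t))) * (u (j - 1) - u j) * norm (x j - snd (z t))
        + sgn (x j - snd (z t)) \<bullet> (- (\<eta> *\<^sub>R S)) * \<sigma> (Delta j (fst (z t)))) \<le> 0"
    unfolding sum.distrib by linarith
qed

text \<open>Summation by parts pairs \<open>deriv \<sigma>\<close> with its own argument, where the
  sign condition applies. This bounds the orientations themselves, whereas the energy sees only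
  their differences.\<close>

lemma norm_fst_nonincreasing:
  assumes sign: "\<And>\<theta>. deriv \<sigma> \<theta> * \<theta> \<ge> 0"
  shows "norm (fst (z T)) \<le> norm (fst (z 0))"
proof -
  have "(\<Sum>j\<in>UNIV. (fst (z T) $ j)\<^sup>2) \<le> (\<Sum>j\<in>UNIV. (fst (z 0) $ j)\<^sup>2)"
  proof (rule nonincreasing_if_derivative_nonpos[OF T])
    fix t assume t: "t \<in> {0..T}"
    let ?u = "\<lambda>j. fst (grain_field \<gamma> \<eta> \<sigma> x (z t)) $ j"
    define p where "p j = deriv \<sigma> (Delta j (fst (z t))) * norm (x j - snd (z t))" for j
    show "((\<lambda>s. \<Sum>j\<in>UNIV. (fst (z s) $ j)\<^sup>2) has_real_derivative
        (\<Sum>j\<in>UNIV. 2 * ?u j * fst (z t) $ j)) (at t within {0..T})"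
      by (intro DERIV_sum) (auto intro!: derivative_eq_intros fst_deriv t)
    have "(\<Sum>j\<in>UNIV. 2 * ?u j * fst (z t) $ j) = - 2 * \<gamma> * (\<Sum>j\<in>UNIV. (p (j + 1) - p j) * fst (z t) $ j)"
      by (simp add: fst_grain_field_nth p_def sum_distrib_left sum_negf algebra_simps)
    also have "\<dots> = - 2 * \<gamma> * (\<Sum>j\<in>UNIV. p j * Delta j (fst (z t)))"
      unfolding Delta_def sum_by_parts_cyclic ..
    also have "\<dots> \<le> 0"
    proof -
      have "0 \<le> p j * Delta j (fst (z t))" for j
        using mult_nonneg_nonneg[OF sign[of "Delta j (fst (z t))"] norm_ge_zero[of "x j - snd (z t)"]]
        by (simp add: p_def algebra_simps)
      then show ?thesis using \<gamma> by (simp add: sum_nonneg)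
    qed
    finally show "(\<Sum>j\<in>UNIV. 2 * ?u j * fst (z t) $ j) \<le> 0" .
  qed
  then show ?thesis
    by (simp add: norm_vec_def L2_set_def)
qed

end

section \<open>Confinement near the equilibrium and the global solution\<close>

text \<open>A junction outside one of the balls competes in the infimum defining
  \<open>C1 x\<close>; since every tension is at least \<open>\<sigma> 0\<close>, its energy would
  then be at least \<open>\<sigma> 0 * C1 x\<close>.\<close>

lemma near_equilibrium_if_energy_small:
  assumes min: "\<And>\<theta>. \<sigma> \<theta> \<ge> \<sigma> 0" and "\<sigma> 0 > 0"
    and small: "grain_energy \<sigma> x z < \<sigma> 0 * C1 x"
  shows "norm (snd z - equilibrium x) < 1/2 * norm (x j - equilibrium x)"
proof (rule ccontr)
  assume "\<not> ?thesis"
  then have "C1 x \<le> (\<Sum>j\<in>UNIV. norm (x j - snd z))"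
    unfolding C1_def by (intro cINF_lower bdd_belowI2[where m = 0]) (auto intro: sum_nonneg simp: not_less)
  then have "\<sigma> 0 * C1 x \<le> (\<Sum>j\<in>UNIV. \<sigma> 0 * norm (x j - snd z))"
    using \<open>\<sigma> 0 > 0\<close> by (simp flip: sum_distrib_left)
  also have "\<dots> \<le> grain_energy \<sigma> x z"
    unfolding grain_energy_def by (intro sum_mono mult_right_mono min) auto
  finally show False using small by simp
qed

theorem theorem4p4:
  fixes \<gamma> \<eta> :: real and \<sigma> :: "real \<Rightarrow> real"
    and x :: "3 \<Rightarrow> real^2" and \<alpha>\<^sub>0 :: "real^3" and a\<^sub>0 :: "real^2"
  assumes "\<gamma> > 0" and "\<eta> > 0"
    and "Ck 3 \<sigma>"
    and "\<And>\<theta>. \<sigma> \<theta> \<ge> \<sigma> 0" and "\<sigma> 0 > 0"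
    and "\<And>\<theta>. deriv \<sigma> \<theta> * \<theta> \<ge> 0"
    and "deriv (deriv \<sigma>) 0 > 0"
    and "\<And>\<theta>. deriv \<sigma> \<theta> = 0 \<longleftrightarrow> \<theta> = 0"
    and "\<And>i. norm (\<Sum>j\<in>UNIV - {i}. (x j - x i) /\<^sub>R norm (x j - x i)) > 1"
    and "(\<Sum>j\<in>UNIV. \<sigma> (Delta j \<alpha>\<^sub>0) * norm (a\<^sub>0 - x j)) < \<sigma> 0 * C1 x"
  shows "\<exists>\<alpha> a. grain_solution \<gamma> \<eta> \<sigma> x {0..} \<alpha> a \<and> \<alpha> 0 = \<alpha>\<^sub>0 \<and> a 0 = a\<^sub>0 \<and>
    (\<forall>\<beta> b. grain_solution \<gamma> \<eta> \<sigma> x {0..} \<beta> b \<and> \<beta> 0 = \<alpha>\<^sub>0 \<and> b 0 = a\<^sub>0 \<longrightarrow>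
       (\<forall>t\<ge>0. \<beta> t = \<alpha> t \<and> b t = a t))"
proof -
  let ?F = "grain_field \<gamma> \<eta> \<sigma> x"
  define e where "e = equilibrium x"
  define r where "r j = 1/2 * norm (x j - e)" for j
  define z\<^sub>0 where "z\<^sub>0 = (\<alpha>\<^sub>0, a\<^sub>0)"
  \<comment> \<open>\<open>U\<close> collects the strict bounds and \<open>K\<close> their closed
    versions, for the first-exit argument. The extra 1 in the radius puts every orientation of norm
    at most \<open>norm \<alpha>\<^sub>0\<close> strictly inside.\<close>
  define U where "U = ball (0 :: real^3) (norm \<alpha>\<^sub>0 + 1) \<times> (\<Inter>j. ball e (r j))"
  define K where "K = cball (0 :: real^3) (norm \<alpha>\<^sub>0 + 1) \<times> (\<Inter>j. cball e (r j))"
  have small: "grain_energy \<sigma> x z\<^sub>0 < \<sigma> 0 * C1 x"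
    using assms(10) by (simp add: grain_energy_def z\<^sub>0_def norm_minus_commute)
  have "open U" "closed K" "convex K" "bounded K" "U \<subseteq> K"
    by (auto simp: U_def K_def intro!: open_Times closed_Times convex_Times bounded_Times convex_INT)
       (auto intro: less_imp_le bounded_subset[OF bounded_cball])
  have in_U: "z \<in> U" if "grain_energy \<sigma> x z \<le> grain_energy \<sigma> x z\<^sub>0" "norm (fst z) \<le> norm \<alpha>\<^sub>0" for z
  proof -
    have "norm (snd z - e) < r j" for j
      unfolding e_def r_def using that(1) small
      by (intro near_equilibrium_if_energy_small[where \<sigma> = \<sigma>] assms) auto
    with that(2) show ?thesis
      by (auto simp: U_def dist_norm norm_minus_commute mem_Times_iff)
  qed
  then have "z\<^sub>0 \<in> U" by (simp add: z\<^sub>0_def)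
  then have r_pos: "0 < r j" for j
    using zero_le_dist[of e a\<^sub>0] by (auto simp: U_def z\<^sub>0_def simp del: zero_le_dist intro: le_less_trans)
  \<comment> \<open>Since \<open>norm (x j - e)\<close> is \<open>2 * r j\<close>, a point within
    \<open>r j\<close> of \<open>e\<close> keeps distance at least \<open>r j\<close> from
    \<open>x j\<close>.\<close>
  have away: "r j \<le> norm (x j - snd z)" if "z \<in> K" for j z
  proof -
    have "dist e (snd z) \<le> r j" using that by (auto simp: K_def)
    then show ?thesis
      using norm_triangle_ineq[of "x j - snd z" "snd z - e"]
      by (simp add: r_def dist_norm norm_minus_commute)
  qed
  have ne: "snd z \<noteq> x j" if "z \<in> K" for j z
    using away[OF that, of j] r_pos[of j] by auto
  have \<sigma>: "(\<sigma> has_real_derivative deriv \<sigma> \<theta>) (at \<theta>)" for \<theta>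
    using \<open>Ck 3 \<sigma>\<close> by (auto simp: Ck_def dest: spec[where x = 0])
  have "z\<^sub>0 \<in> K" using \<open>z\<^sub>0 \<in> U\<close> \<open>U \<subseteq> K\<close> by blast
  \<comment> \<open>Projection onto a closed convex set is 1-Lipschitz, so \<open>?F\<close> after
    \<open>P\<close> is Lipschitz on the whole space.\<close>
  define P where "P = closest_point K"
  have P: "P z = z" if "z \<in> K" for z
    unfolding P_def using that by (rule closest_point_self)
  have "lipschitzian_on UNIV (\<lambda>z. ?F (P z))"
  proof (rule lipschitzian_on_compose[where f = P and g = "?F"])
    have "1-lipschitz_on UNIV P"
      unfolding P_def using \<open>convex K\<close> \<open>closed K\<close> \<open>z\<^sub>0 \<in> K\<close>
      by (intro lipschitz_onI) (auto intro: closest_point_lipschitz)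
    then show "lipschitzian_on UNIV P"
      by (auto simp: lipschitzian_on_def)
    have "range P \<subseteq> K"
      unfolding P_def using \<open>closed K\<close> \<open>z\<^sub>0 \<in> K\<close> by (auto intro: closest_point_in_set)
    moreover have "lipschitzian_on K ?F"
      using away r_pos by (intro lipschitzian_on_grain_field assms \<open>bounded K\<close>) blast
    ultimately show "lipschitzian_on (range P) ?F"
      unfolding lipschitzian_on_def by (blast intro: lipschitz_on_subset)
  qed
  then obtain L where L: "L-lipschitz_on UNIV (\<lambda>z. ?F (P z))"
    by (auto simp: lipschitzian_on_def)
  \<comment> \<open>Stated for any curve solving the original system up to \<open>T\<close>, so that
    it serves both the constructed solution and an arbitrary competitor.\<close>
  have step: "z T \<in> U"
    if "T \<ge> 0" "z 0 = z\<^sub>0" "\<And>t j. t \<in> {0..T} \<Longrightarrow> snd (z t) \<noteq> x j"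
      "\<And>t. t \<in> {0..T} \<Longrightarrow> (z has_vector_derivative ?F (z t)) (at t within {0..})" for z T
  proof (rule in_U)
    have z: "(z has_vector_derivative ?F (z t)) (at t within {0..T})" if "t \<in> {0..T}" for t
      using \<open>\<And>t. t \<in> {0..T} \<Longrightarrow> (z has_vector_derivative ?F (z t)) (at t within {0..})\<close>[OF that]
      by (rule has_vector_derivative_within_subset) auto
    show "grain_energy \<sigma> x (z T) \<le> grain_energy \<sigma> x z\<^sub>0"
      using grain_energy_nonincreasing[OF assms(1) \<open>T \<ge> 0\<close> z assms(2) \<sigma> that(3)] \<open>z 0 = z\<^sub>0\<close> by simp
    show "norm (fst (z T)) \<le> norm \<alpha>\<^sub>0"
      using norm_fst_nonincreasing[OF assms(1) \<open>T \<ge> 0\<close> z assms(6)] \<open>z 0 = z\<^sub>0\<close> by (simp add: z\<^sub>0_def)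
  qed
  obtain z where z: "z 0 = z\<^sub>0"
    "\<And>t. t \<ge> 0 \<Longrightarrow> (z has_vector_derivative ?F (P (z t))) (at t within {0..})"
    using lipschitz_ivp_global_solution[OF L] by blast
  have cont_z: "continuous_on {0..} z"
    using z(2) by (auto simp: continuous_on_eq_continuous_within intro: has_vector_derivative_continuous)
  have z_K: "z t \<in> K" if "t \<ge> 0" for t
  proof -
    have "z t \<in> U"
    \<comment> \<open>As long as \<open>z\<close> has remained in \<open>K\<close>, \<open>P\<close>
      acts as the identity along it, so \<open>z\<close> solves the original system there and
      \<open>step\<close> applies.\<close>
    proof (rule stays_in_if_no_first_exit[OF cont_z \<open>open U\<close> \<open>closed K\<close> \<open>U \<subseteq> K\<close> _ _ that])
      show "z 0 \<in> K" using z(1) \<open>z\<^sub>0 \<in> K\<close> by simp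
      fix T assume T: "T \<ge> 0" and K: "\<And>t. t \<in> {0..T} \<Longrightarrow> z t \<in> K"
      show "z T \<in> U"
      proof (rule step[where z = z, OF T z(1)])
        show "snd (z t) \<noteq> x j" if "t \<in> {0..T}" for t j
          using K[OF that] by (rule ne)
        show "(z has_vector_derivative ?F (z t)) (at t within {0..})" if "t \<in> {0..T}" for t
          using z(2)[of t] P[OF K[OF that]] that by simp
      qed
    qed
    then show ?thesis using \<open>U \<subseteq> K\<close> by blast
  qed
  have sol: "grain_solution \<gamma> \<eta> \<sigma> x {0..} (\<lambda>t. fst (z t)) (\<lambda>t. snd (z t))"
  proof (rule grain_solution_if_has_vector_derivative)
    show "(z has_vector_derivative ?F (z t)) (at t within {0..})" if "t \<in> {0..}" for t
      using z(2)[of t] P[OF z_K] that by simp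
    \<comment> \<open>Continuity of the velocity is taken from the projected field, which agrees
      with \<open>?F\<close> along \<open>z\<close>.\<close>
    have "continuous_on {0..} (\<lambda>t. ?F (P (z t)))"
      by (rule continuous_on_compose2[OF lipschitz_on_continuous_on[OF L] cont_z]) simp
    then show "continuous_on {0..} (\<lambda>t. ?F (z t))"
      by (rule continuous_on_eq) (simp add: P z_K)
    show "snd (z t) \<noteq> x j" if "t \<in> {0..}" for t j
      using that by (intro ne z_K) simp
  qed
  have unique: "\<beta> t = fst (z t) \<and> b t = snd (z t)"
    if sol': "grain_solution \<gamma> \<eta> \<sigma> x {0..} \<beta> b" and init: "\<beta> 0 = \<alpha>\<^sub>0" "b 0 = a\<^sub>0" and "t \<ge> 0" for \<beta> b t
  proof -
    define w where "w t = (\<beta> t, b t)" for t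
    have w: "(w has_vector_derivative ?F (w t)) (at t within {0..})" if "t \<ge> 0" for t
      using has_vector_derivative_if_grain_solution[OF sol', of t] that by (simp add: w_def[abs_def])
    \<comment> \<open>A competitor solves the original system and avoids the \<open>x j\<close> by
      definition, so \<open>step\<close> confines it directly. It then solves the projected equation
      too, where uniqueness holds.\<close>
    have "w t \<in> U" if "t \<ge> 0" for t
    proof (rule step[where z = w, OF that])
      show "w 0 = z\<^sub>0" by (simp add: w_def z\<^sub>0_def init)
      show "snd (w s) \<noteq> x j" if "s \<in> {0..t}" for s j
        using sol' that by (simp add: w_def grain_solution_def)
    qed (simp add: w)
    then have w_K: "w t \<in> K" if "t \<ge> 0" for t
      using \<open>U \<subseteq> K\<close> that by blast
    have "(w has_vector_derivative ?F (P (w t))) (at t within {0..})" if "t \<ge> 0" for t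
      using w[OF that] P[OF w_K[OF that]] by simp
    from lipschitz_ivp_unique[OF L this z(2) _ \<open>t \<ge> 0\<close>] have "w t = z t"
      by (simp add: w_def z(1) z\<^sub>0_def init)
    then show ?thesis by (simp add: w_def prod_eq_iff)
  qed
  show ?thesis
  proof (rule exI[of _ "\<lambda>t. fst (z t)"], rule exI[of _ "\<lambda>t. snd (z t)"], intro conjI allI impI)
    show "fst (z 0) = \<alpha>\<^sub>0" "snd (z 0) = a\<^sub>0"
      by (simp_all add: z(1) z\<^sub>0_def)
    fix \<beta> b and t :: real
    assume *: "grain_solution \<gamma> \<eta> \<sigma> x {0..} \<beta> b \<and> \<beta> 0 = \<alpha>\<^sub>0 \<and> b 0 = a\<^sub>0" and "0 \<le> t"
    have "\<beta> t = fst (z t) \<and> b t = snd (z t)"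
      by (rule unique) (simp_all add: * \<open>0 \<le> t\<close>)
    then show "\<beta> t = fst (z t)" "b t = snd (z t)"
      by simp_all
  qed (rule sol)
qed

end
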